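(* Consider the multi-criteria problem with feasible set $S$ and real-valued criteria $F_1,\dots,F_n$ (each to be maximized or minimized), with best values $K_i$ and worst values $W_i$. Define the normalized criteria $$f_i(\vec X)=\frac{F_i(\vec X)-\min(K_i,W_i)}{\max(K_i,W_i)-\min(K_i,W_i)},\qquad i=1,\dots,n,$$ where $f_i$ is to be maximized if $F_i$ is to be maximized and minimized if $F_i$ is to be minimized. If $\vec X\in S$ is Pareto-optimal for the multi-criteria problem over $S$ with criteria $f_1,\dots,f_n$, then $\vec X$ is Pareto-optimal for the multi-criteria problem over $S$ with criteria $F_1,\dots,F_n$.
   Context: Multi-criteria problem: vectors of variables are $\vec X=(x_1,\dots,x_m)$ with $x_k\in X_k$ for given sets $X_k$, subject to restrictions $\varphi_j(\vec X)\le b_j$ for all $j$, where the $\varphi_j$ are real-valued functions and the $b_j$ are real numbers. The feasible set $S$ is the set of all such $\vec X$ satisfying all restrictions. There are $n\ge 1$ real-valued criteria $F_i(\vec X)$, $i\in I=\{1,\dots,n\}$, and for each $i$ it is specified whether $F_i$ is to be maximized or minimized. Best and worst values: if $F_i$ is to be maximized, then $K_i=\max_{S}F_i$ and $W_i=\min_{S}F_i$; if $F_i$ is to be minimized, then $K_i=\min_{S}F_i$ and $W_i=\max_{S}F_i$. Standing assumptions: these extrema exist, and $K_i\ne W_i$ for every $i$. Pareto-optimality: for a problem over $S$ with criteria $G_1,\dots,G_n$, each to be maximized or minimized, $\vec X\in S$ is Pareto-optimal if there is no $\vec X'\in S$ such that, for every $i$, $G_i(\vec X')$ is at least as good as $G_i(\vec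 X)$ (that is, $\ge$ if $G_i$ is maximized, $\le$ if $G_i$ is minimized), with strict improvement for at least one $i$. *)

theory Defs
  imports Complex_Main "HOL-Library.FuncSet"
begin

(* Vectors (x_1, ..., x_m) are functions on {1..m}, extended by undefined elsewhere. The components
   have one common type; different ground sets X_k are represented as different subsets of it. *)
definition feasible_set ::
  "nat \<Rightarrow> (nat \<Rightarrow> 'a set) \<Rightarrow> 'j set \<Rightarrow> ('j \<Rightarrow> (nat \<Rightarrow> 'a) \<Rightarrow> real) \<Rightarrow> ('j \<Rightarrow> real) \<Rightarrow> (nat \<Rightarrow> 'a) set"
  where "feasible_set m X J \<phi> b = {x \<in> (\<Pi>\<^sub>E k\<in>{1..m}. X k). \<forall>j\<in>J. \<phi> j x \<le> b j}"

datatype direction = Maximize | Minimize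

fun at_least_as_good :: "direction \<Rightarrow> real \<Rightarrow> real \<Rightarrow> bool" where
  "at_least_as_good Maximize u v \<longleftrightarrow> u \<ge> v"
| "at_least_as_good Minimize u v \<longleftrightarrow> u \<le> v"

fun strictly_better :: "direction \<Rightarrow> real \<Rightarrow> real \<Rightarrow> bool" where
  "strictly_better Maximize u v \<longleftrightarrow> u > v"
| "strictly_better Minimize u v \<longleftrightarrow> u < v"

definition pareto_optimal ::
  "'v set \<Rightarrow> nat \<Rightarrow> (nat \<Rightarrow> direction) \<Rightarrow> (nat \<Rightarrow> 'v \<Rightarrow> real) \<Rightarrow> 'v \<Rightarrow> bool"
  where "pareto_optimal S n dir G x \<longleftrightarrow>
    x \<in> S \<and>
    \<not> (\<exists>x'\<in>S. (\<forall>i\<in>{1..n}. at_least_as_good (dir i) (G i x') (G i x)) \<and>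
              (\<exists>i\<in>{1..n}. strictly_better (dir i) (G i x') (G i x)))"

definition has_maximum_on :: "('v \<Rightarrow> real) \<Rightarrow> 'v set \<Rightarrow> bool"
  where "has_maximum_on g S \<longleftrightarrow> (\<exists>x\<in>S. \<forall>y\<in>S. g y \<le> g x)"

definition has_minimum_on :: "('v \<Rightarrow> real) \<Rightarrow> 'v set \<Rightarrow> bool"
  where "has_minimum_on g S \<longleftrightarrow> (\<exists>x\<in>S. \<forall>y\<in>S. g x \<le> g y)"

(* S may be infinite, so Max and Min do not apply. The following two values are meaningful only when
   the corresponding extremum is attained. *)
definition maximum_on :: "('v \<Rightarrow> real) \<Rightarrow> 'v set \<Rightarrow> real"
  where "maximum_on g S = (GREATEST v. v \<in> g ` S)"

definition minimum_on :: "('v \<Rightarrow> real) \<Rightarrow> 'v set \<Rightarrow> real"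
  where "minimum_on g S = (LEAST v. v \<in> g ` S)"

fun best_value :: "direction \<Rightarrow> ('v \<Rightarrow> real) \<Rightarrow> 'v set \<Rightarrow> real" where
  "best_value Maximize g S = maximum_on g S"
| "best_value Minimize g S = minimum_on g S"

fun worst_value :: "direction \<Rightarrow> ('v \<Rightarrow> real) \<Rightarrow> 'v set \<Rightarrow> real" where
  "worst_value Maximize g S = minimum_on g S"
| "worst_value Minimize g S = maximum_on g S"

definition normalized :: "real \<Rightarrow> real \<Rightarrow> ('v \<Rightarrow> real) \<Rightarrow> 'v \<Rightarrow> real"
  where "normalized K W g x = (g x - min K W) / (max K W - min K W)"

end

theory Submission
  imports Defs
begin

text \<open>
  Pareto-optimality depends on the criteria only through the order that each of them induces on
  the feasible set. As \<^term>\<open>K i \<noteq> W i\<close>, the denominator of the normalization is positive, so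
  every normalized criterion is a strictly increasing affine function of the original one and
  induces the same order; since it also keeps its direction, a vector that dominates another one
  for the original criteria dominates it for the normalized criteria as well.
\<close>

lemma normalized_le_iff:
  assumes "K \<noteq> W"
  shows "normalized K W g y \<le> normalized K W g z \<longleftrightarrow> g y \<le> g z"
proof -
  have "max K W - min K W > 0"
    using assms by (auto simp: max_def min_def)
  then show ?thesis
    by (simp add: normalized_def divide_le_cancel)
qed

lemma at_least_as_good_normalized_iff:
  assumes "K \<noteq> W"
  shows "at_least_as_good d (normalized K W g y) (normalized K W g z)
    \<longleftrightarrow> at_least_as_good d (g y) (g z)"
  by (cases d) (simp_all add: normalized_le_iff[OF assms])

lemma strictly_better_normalized_iff:
  assumes "K \<noteq> W"
  shows "strictly_better d (normalized K W g y) (normalized K W g z)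
    \<longleftrightarrow> strictly_better d (g y) (g z)"
  by (cases d) (simp_all add: normalized_le_iff[OF assms] flip: not_le)

theorem theorem5:
  fixes m n :: nat
    and X :: "nat \<Rightarrow> 'a set"
    and J :: "'j set"
    and \<phi> :: "'j \<Rightarrow> (nat \<Rightarrow> 'a) \<Rightarrow> real"
    and b :: "'j \<Rightarrow> real"
    and S :: "(nat \<Rightarrow> 'a) set"
    and dir :: "nat \<Rightarrow> direction"
    and F f :: "nat \<Rightarrow> (nat \<Rightarrow> 'a) \<Rightarrow> real"
    and K W :: "nat \<Rightarrow> real"
    and x :: "nat \<Rightarrow> 'a"
  assumes "n \<ge> 1"
    and "S = feasible_set m X J \<phi> b"
    and "\<And>i. i \<in> {1..n} \<Longrightarrow> has_maximum_on (F i) S"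
    and "\<And>i. i \<in> {1..n} \<Longrightarrow> has_minimum_on (F i) S"
    and "\<And>i. i \<in> {1..n} \<Longrightarrow> K i = best_value (dir i) (F i) S"
    and "\<And>i. i \<in> {1..n} \<Longrightarrow> W i = worst_value (dir i) (F i) S"
    and "\<And>i. i \<in> {1..n} \<Longrightarrow> K i \<noteq> W i"
    and "\<And>i. i \<in> {1..n} \<Longrightarrow> f i = normalized (K i) (W i) (F i)"
    and "x \<in> S"
    and "pareto_optimal S n dir f x"
  shows "pareto_optimal S n dir F x"
proof -
  have "at_least_as_good (dir i) (f i y) (f i z) \<longleftrightarrow> at_least_as_good (dir i) (F i y) (F i z)"
    and "strictly_better (dir i) (f i y) (f i z) \<longleftrightarrow> strictly_better (dir i) (F i y) (F i z)"
    if "i \<in> {1..n}" for i y z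
    using assms(7,8)[OF that]
    by (simp_all add: at_least_as_good_normalized_iff strictly_better_normalized_iff)
  then have "pareto_optimal S n dir f x \<longleftrightarrow> pareto_optimal S n dir F x"
    unfolding pareto_optimal_def by (simp del: atLeastAtMost_iff cong: ball_cong bex_cong)
  with assms(10) show ?thesis
    by simp
qed

end
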